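(* Let $\Lambda\subseteq\mathbb{R}^d$ be a $d$-dimensional lattice and $F,G\colon K\to\mathbb{R}$ two $\Lambda$-periodic filters on a $\Lambda$-periodic cell complex $K$. Then $d_I(\mathcal{M}(F,\Lambda),\mathcal{M}(G,\Lambda))\le\|F-G\|_\infty$, and hence $J([\mathcal{M}(F,\Lambda)],[\mathcal{M}(G,\Lambda)])\le\|F-G\|_\infty$, where $\|F-G\|_\infty=\sup_{\sigma\in K}|F(\sigma)-G(\sigma)|$.
   Context: A cell complex $K$ in $\mathbb{R}^d$ is a locally finite collection of cells (each homeomorphic to a closed ball, boundaries unions of lower-dimensional cells, intersections unions of shared faces). A lattice spanned by linearly independent $u_1,\dots,u_p\in\mathbb{R}^d$ is the set of their integer combinations, of dimension $p$; $\mathrm{vol}_p$ denotes the $p$-dimensional volume of its unit cell $\{\sum c_iu_i: c_i\in[0,1)\}$ ($\mathrm{vol}_0(\{0\})=1$). $K$ is $\Lambda$-periodic if $\sigma+u\in K$ for $\sigma\in K,u\in\Lambda$; a filter $F\colon K\to\mathbb{R}$ satisfies $F(\sigma)\le F(\tau)$ when $\sigma$ is a face of $\tau$, and is $\Lambda$-periodic if $F(\sigma+u)=F(\sigma)$. $K/\Lambda$ is the finite quotient complex on the torus $\mathbb{R}^d/\Lambda$ and $F/\Lambda$ the quotient filter. The merge tree of a filter on a complex $L$ is the quotient of $\{(x,s): x\in L_s\}$ ($L_s$ the sublevel set at $s$) by $(x,s)\sim(y,t)$ iff $s=t$ and $x,y$ lie in the same component of $L_s$, with quotient topology and height $h$ (the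 $s$-coordinate); points are identified with components of sublevel sets; $B$ covers $A$ if $h(A)\le h(B)$ and $A\subseteq B$. For a component $\Gamma$ of $(K/\Lambda)_t$, with $\phi\colon\mathbb{R}^d\to\mathbb{R}^d/\Lambda$ the projection, a shadow is a component of $\phi^{-1}(\Gamma)$ and the periodicity lattice is $\Lambda_\Gamma=\{u\in\Lambda:\gamma+u=\gamma\}$ for a shadow $\gamma$; with $p=\dim\Lambda_\Gamma$ and $\nu_q$ the volume of the unit $q$-ball, the shadow monomial is $\frac{\mathrm{vol}_p(\Lambda_\Gamma)}{\mathrm{vol}_d(\Lambda)}\nu_{d-p}R^{d-p}$. The periodic merge tree $\mathcal{M}(F,\Lambda)$ is the merge tree of $F/\Lambda$ with height $h$ and frequency function $\Phi$ assigning each point its shadow monomial. Monomials are ordered by $tR^a<sR^b$ iff $a<b$, or $a=b$ and $t<s$. Interleaving distance: continuous maps $\varphi\colon\mathcal{M}\to\mathcal{M}'$, $\psi\colon\mathcal{M}'\to\mathcal{M}$ between periodic merge trees (heights $h,h'$, frequencies $\Phi,\Phi'$) are $\varepsilon$-compatible if for all $\Gamma\in\mathcal{M}$, $\Gamma'\in\mathcal{M}'$: (i) $h'(\varphi(\Gamma))=h(\Gamma)+\varepsilon$, $h(\psi(\Gamma'))=h'(\Gamma')+\varepsilon$; (ii) $\psi(\varphi(\Gamma))$ covers $\Gamma$ and $\varphi(\psi(\Gamma'))$ covers $\Gamma'$; (iii) $\Phi'(\varphi(\Gamma))\le\Phi(\Gamma)$, $\Phi(\psi(\Gamma'))\le\Phi'(\Gamma')$.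 $d_I(\mathcal{M},\mathcal{M}')$ is the infimum of such $\varepsilon\ge0$. Splintering: $\mathcal{M}_\Gamma$ is the subtree of points covered by $\Gamma$. $\mathcal{M}'$ splinters $\mathcal{M}$ if there is a continuous surjection $\omega\colon\mathcal{M}'\to\mathcal{M}$ with $h\circ\omega=h'$ such that for every $\Gamma\in\mathcal{M}$ and all $A,B\in\omega^{-1}(\Gamma)$: $d_I(\mathcal{M}'_A,\mathcal{M}'_B)=0$, $\omega$ maps each of $\mathcal{M}'_A,\mathcal{M}'_B$ onto $\mathcal{M}_\Gamma$, and $\Phi'(A)=\Phi'(B)=\Phi(\Gamma)/|\omega^{-1}(\Gamma)|$. $\mathcal{M}\simeq\mathcal{N}$ if some periodic merge tree splinters both; $[\mathcal{M}]$ is the class. $J([\mathcal{M}],[\mathcal{M}'])=\inf\sum_{i=1}^k d_I(\mathcal{M}_i,\mathcal{M}_i')$ over finite sequences with $\mathcal{M}_1\in[\mathcal{M}]$, $\mathcal{M}_k'\in[\mathcal{M}']$, $\mathcal{M}_i'\simeq\mathcal{M}_{i+1}$. *)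

theory Defs
  imports "HOL-Analysis.Analysis"
begin

definition qtop :: "'a topology \<Rightarrow> ('a \<Rightarrow> 'b) \<Rightarrow> 'b topology" where
  "qtop X f = topology (\<lambda>U. U \<subseteq> f ` topspace X \<and> openin X {x \<in> topspace X. f x \<in> U})"

lemma istopology_qtop:
  "istopology (\<lambda>U. U \<subseteq> f ` topspace X \<and> openin X {x \<in> topspace X. f x \<in> U})"
proof -
  have i: "openin X {x \<in> topspace X. f x \<in> S \<inter> T}"
    if "openin X {x \<in> topspace X. f x \<in> S}" "openin X {x \<in> topspace X. f x \<in> T}" for S T
  proof -
    have "{x \<in> topspace X. f x \<in> S \<inter> T} =
       {x \<in> topspace X. f x \<in> S} \<inter> {x \<in> topspace X. f x \<in> T}" by auto
    then show ?thesis using that by auto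
  qed
  have u: "openin X {x \<in> topspace X. f x \<in> \<Union>\<K>}"
    if "\<forall>U\<in>\<K>. openin X {x \<in> topspace X. f x \<in> U}" for \<K>
  proof -
    have "{x \<in> topspace X. f x \<in> \<Union>\<K>} = \<Union>((\<lambda>U. {x \<in> topspace X. f x \<in> U}) ` \<K>)"
      by auto
    moreover have "openin X (\<Union>((\<lambda>U. {x \<in> topspace X. f x \<in> U}) ` \<K>))"
      using that by (intro openin_Union) auto
    ultimately show ?thesis by simp
  qed
  show ?thesis unfolding istopology_def
    using i u by blast
qed

lemma openin_qtop:
  "openin (qtop X f) U \<longleftrightarrow> U \<subseteq> f ` topspace X \<and> openin X {x \<in> topspace X. f x \<in> U}"
  unfolding qtop_def using istopology_qtop[of f X] by (simp add: topology_inverse')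

definition cdim :: "'a::euclidean_space set \<Rightarrow> nat" where
  "cdim \<sigma> = (THE k. \<exists>S::'a set. subspace S \<and> dim S = k \<and> \<sigma> homeomorphic (cball 0 1 \<inter> S))"

definition cell_complex :: "'a::euclidean_space set set \<Rightarrow> bool" where
  "cell_complex K \<longleftrightarrow>
     \<comment> \<open>each cell is homeomorphic to a closed ball; its boundary (image of the sphere)
        is a union of lower-dimensional cells of K\<close>
     (\<forall>\<sigma>\<in>K. \<exists>(S::'a set) h h'. subspace S \<and> homeomorphism (cball 0 1 \<inter> S) \<sigma> h h' \<and>
          (\<exists>T\<subseteq>K. (\<forall>\<tau>\<in>T. cdim \<tau> < dim S) \<and> h ` (sphere 0 1 \<inter> S) = \<Union>T)) \<and>
     \<comment> \<open>intersections are unions of shared faces\<close>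
     (\<forall>\<sigma>\<in>K. \<forall>\<tau>\<in>K. \<sigma> \<inter> \<tau> = \<Union>{\<rho>\<in>K. \<rho> \<subseteq> \<sigma> \<and> \<rho> \<subseteq> \<tau>}) \<and>
     \<comment> \<open>local finiteness\<close>
     (\<forall>x. \<exists>e>0. finite {\<sigma>\<in>K. \<sigma> \<inter> ball x e \<noteq> {}})"

text \<open>Faces: \<open>\<sigma>\<close> is a face of \<open>\<tau>\<close> iff \<open>\<sigma> \<subseteq> \<tau>\<close> (both cells of K).\<close>

definition filter_on :: "'a::euclidean_space set set \<Rightarrow> ('a set \<Rightarrow> real) \<Rightarrow> bool" where
  "filter_on K F \<longleftrightarrow> (\<forall>\<sigma>\<in>K. \<forall>\<tau>\<in>K. \<sigma> \<subseteq> \<tau> \<longrightarrow> F \<sigma> \<le> F \<tau>)"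

definition int_span :: "'a::euclidean_space set \<Rightarrow> 'a set" where
  "int_span U = {\<Sum>u\<in>U. of_int (c u) *\<^sub>R u | c. True}"

definition is_lattice :: "'a::euclidean_space set \<Rightarrow> bool" where
  "is_lattice L \<longleftrightarrow> (\<exists>U. finite U \<and> independent U \<and> L = int_span U)"

text \<open>Dimension of a lattice: number of generators = dimension of its span.\<close>

definition lattice_dim :: "'a::euclidean_space set \<Rightarrow> nat" where
  "lattice_dim L = dim L"

definition unit_cell :: "'a::euclidean_space set \<Rightarrow> 'a set" where
  "unit_cell U = {\<Sum>u\<in>U. c u *\<^sub>R u | c. \<forall>u\<in>U. 0 \<le> c u \<and> c u < 1}"

text \<open>p-dimensional volume of a set lying in a p-dimensional subspace V: Lebesgue measure
  on R^p of its image under the coordinate map w.r.t. an orthonormal basis b_0..b_(p-1) of V.\<close>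

definition pvol :: "nat \<Rightarrow> 'a::euclidean_space set \<Rightarrow> 'a set \<Rightarrow> real" where
  "pvol p V A = (let b = (SOME b :: nat \<Rightarrow> 'a. (\<forall>i<p. \<forall>j<p. b i \<bullet> b j = (if i = j then 1 else 0))
                                            \<and> span (b ` {..<p}) = V)
                 in measure (PiM {..<p} (\<lambda>_. lborel :: real measure)) ((\<lambda>x. \<lambda>i\<in>{..<p}. x \<bullet> b i) ` A))"

definition lattice_vol :: "'a::euclidean_space set \<Rightarrow> real" where
  "lattice_vol L = (let U = (SOME U. finite U \<and> independent U \<and> L = int_span U)
                    in pvol (card U) (span U) (unit_cell U))"

definition periodic_complex :: "'a::euclidean_space set set \<Rightarrow> 'a set \<Rightarrow> bool" where
  "periodic_complex K L \<longleftrightarrow> (\<forall>\<sigma>\<in>K. \<forall>u\<in>L. (\<lambda>x. x + u) ` \<sigma> \<in> K)"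

definition periodic_filter :: "'a::euclidean_space set set \<Rightarrow> 'a set \<Rightarrow> ('a set \<Rightarrow> real) \<Rightarrow> bool" where
  "periodic_filter K L F \<longleftrightarrow> filter_on K F \<and> (\<forall>\<sigma>\<in>K. \<forall>u\<in>L. F ((\<lambda>x. x + u) ` \<sigma>) = F \<sigma>)"

text \<open>Points of the torus R^d/L are the cosets x + L; \<open>tproj L\<close> is the projection \<open>\<phi>\<close>.\<close>

definition tproj :: "'a::euclidean_space set \<Rightarrow> 'a \<Rightarrow> 'a set" where
  "tproj L x = {x + u | u. u \<in> L}"

definition torus_top :: "'a::euclidean_space set \<Rightarrow> 'a set topology" where
  "torus_top L = qtop euclidean (tproj L)"

text \<open>Sublevel set at s of the quotient filter F/L on K/L (cells of K/L are the images
  \<open>\<phi>(\<sigma>)\<close>, with (F/L)(\<phi>(\<sigma>)) = F(\<sigma>)).\<close>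

definition tsub :: "'a::euclidean_space set set \<Rightarrow> ('a set \<Rightarrow> real) \<Rightarrow> 'a set \<Rightarrow> real \<Rightarrow> 'a set set" where
  "tsub K F L s = \<Union>{tproj L ` \<sigma> | \<sigma>. \<sigma> \<in> K \<and> F \<sigma> \<le> s}"

definition mt_pt :: "'b topology \<Rightarrow> (real \<Rightarrow> 'b set) \<Rightarrow> 'b \<times> real \<Rightarrow> 'b set \<times> real" where
  "mt_pt T Sub = (\<lambda>(x, s). (connected_component_of_set (subtopology T (Sub s)) x, s))"

definition mt_top :: "'b topology \<Rightarrow> (real \<Rightarrow> 'b set) \<Rightarrow> ('b set \<times> real) topology" where
  "mt_top T Sub = qtop (subtopology (prod_topology T euclideanreal) {(x, s). x \<in> Sub s}) (mt_pt T Sub)"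

text \<open>Monomials t R^a are represented as pairs (a, t).\<close>

type_synonym monomial = "nat \<times> real"

definition mono_le :: "monomial \<Rightarrow> monomial \<Rightarrow> bool" where
  "mono_le m n \<longleftrightarrow> fst m < fst n \<or> (fst m = fst n \<and> snd m \<le> snd n)"

record 'p mtree =
  mtop :: "'p topology"
  hgt :: "'p \<Rightarrow> real"
  frq :: "'p \<Rightarrow> monomial"

type_synonym 'a pmtree = "('a set set \<times> real) mtree"

definition shadow :: "'a::euclidean_space set \<Rightarrow> 'a set set \<Rightarrow> 'a set" where
  "shadow L \<Gamma> = (SOME \<gamma>. \<gamma> \<in> components {y. tproj L y \<in> \<Gamma>})"

definition period_lattice :: "'a::euclidean_space set \<Rightarrow> 'a set set \<Rightarrow> 'a set" where
  "period_lattice L \<Gamma> = {u \<in> L. (\<lambda>y. y + u) ` shadow L \<Gamma> = shadow L \<Gamma>}"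

definition shadow_monomial :: "'a::euclidean_space set \<Rightarrow> 'a set set \<Rightarrow> monomial" where
  "shadow_monomial L \<Gamma> =
     (let P = period_lattice L \<Gamma>; p = lattice_dim P
      in (DIM('a) - p, lattice_vol P / lattice_vol L * unit_ball_vol (real (DIM('a) - p))))"

definition pmt :: "'a::euclidean_space set set \<Rightarrow> ('a set \<Rightarrow> real) \<Rightarrow> 'a set \<Rightarrow> 'a pmtree" where
  "pmt K F L = \<lparr> mtop = mt_top (torus_top L) (tsub K F L), hgt = snd,
                 frq = (\<lambda>\<Gamma>. shadow_monomial L (fst \<Gamma>)) \<rparr>"

definition covers :: "'a pmtree \<Rightarrow> 'a set set \<times> real \<Rightarrow> 'a set set \<times> real \<Rightarrow> bool" where
  "covers M B A \<longleftrightarrow> hgt M A \<le> hgt M B \<and> fst A \<subseteq> fst B"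

definition compatible :: "real \<Rightarrow> 'a pmtree \<Rightarrow> 'a pmtree \<Rightarrow>
     ('a set set \<times> real \<Rightarrow> 'a set set \<times> real) \<Rightarrow> ('a set set \<times> real \<Rightarrow> 'a set set \<times> real) \<Rightarrow> bool" where
  "compatible \<epsilon> M M' \<phi> \<psi> \<longleftrightarrow>
     continuous_map (mtop M) (mtop M') \<phi> \<and> continuous_map (mtop M') (mtop M) \<psi> \<and>
     (\<forall>\<Gamma>\<in>topspace (mtop M). hgt M' (\<phi> \<Gamma>) = hgt M \<Gamma> + \<epsilon> \<and> covers M (\<psi> (\<phi> \<Gamma>)) \<Gamma> \<and>
                                mono_le (frq M' (\<phi> \<Gamma>)) (frq M \<Gamma>)) \<and>
     (\<forall>\<Gamma>'\<in>topspace (mtop M'). hgt M (\<psi> \<Gamma>') = hgt M' \<Gamma>' + \<epsilon> \<and> covers M' (\<phi> (\<psi> \<Gamma>')) \<Gamma>' \<and>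
                                mono_le (frq M (\<psi> \<Gamma>')) (frq M' \<Gamma>'))"

definition dI :: "'a pmtree \<Rightarrow> 'a pmtree \<Rightarrow> ereal" where
  "dI M M' = Inf {ereal \<epsilon> | \<epsilon>. \<epsilon> \<ge> 0 \<and> (\<exists>\<phi> \<psi>. compatible \<epsilon> M M' \<phi> \<psi>)}"

definition subtree :: "'a pmtree \<Rightarrow> 'a set set \<times> real \<Rightarrow> 'a pmtree" where
  "subtree M \<Gamma> = M\<lparr> mtop := subtopology (mtop M) {A \<in> topspace (mtop M). covers M \<Gamma> A} \<rparr>"

definition splinters :: "'a pmtree \<Rightarrow> 'a pmtree \<Rightarrow> bool" where
  "splinters M' M \<longleftrightarrow> (\<exists>\<omega>. continuous_map (mtop M') (mtop M) \<omega> \<and>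
      \<omega> ` topspace (mtop M') = topspace (mtop M) \<and>
      (\<forall>x\<in>topspace (mtop M'). hgt M (\<omega> x) = hgt M' x) \<and>
      (\<forall>\<Gamma>\<in>topspace (mtop M).
         let Fib = {A \<in> topspace (mtop M'). \<omega> A = \<Gamma>} in
         finite Fib \<and>
         (\<forall>A\<in>Fib. \<forall>B\<in>Fib. dI (subtree M' A) (subtree M' B) = 0 \<and>
             \<omega> ` topspace (mtop (subtree M' A)) = topspace (mtop (subtree M \<Gamma>)) \<and>
             \<omega> ` topspace (mtop (subtree M' B)) = topspace (mtop (subtree M \<Gamma>)) \<and>
             frq M' A = (fst (frq M \<Gamma>), snd (frq M \<Gamma>) / real (card Fib)) \<and>
             frq M' B = (fst (frq M \<Gamma>), snd (frq M \<Gamma>) / real (card Fib)))))"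

definition admissible :: "'a::euclidean_space set set \<Rightarrow> ('a set \<Rightarrow> real) \<Rightarrow> 'a set \<Rightarrow> bool" where
  "admissible K F L \<longleftrightarrow> is_lattice L \<and> lattice_dim L = DIM('a) \<and> cell_complex K \<and>
                         periodic_complex K L \<and> periodic_filter K L F"

definition pmtrees :: "'a::euclidean_space pmtree set" where
  "pmtrees = {pmt K F L | K F L. admissible K F L}"

definition pmt_equiv :: "'a::euclidean_space pmtree \<Rightarrow> 'a pmtree \<Rightarrow> bool" where
  "pmt_equiv M N \<longleftrightarrow> M \<in> pmtrees \<and> N \<in> pmtrees \<and> (\<exists>P\<in>pmtrees. splinters P M \<and> splinters P N)"

text \<open>J([M],[M']) (depends only on the classes; stated on representatives).\<close>

definition J_dist :: "'a::euclidean_space pmtree \<Rightarrow> 'a pmtree \<Rightarrow> ereal" where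
  "J_dist M M' = Inf {(\<Sum>i<k. dI (Ms i) (Ms' i)) | k (Ms :: nat \<Rightarrow> 'a pmtree) (Ms' :: nat \<Rightarrow> 'a pmtree). k \<ge> 1 \<and>
       (\<forall>i<k. Ms i \<in> pmtrees \<and> Ms' i \<in> pmtrees) \<and>
       pmt_equiv M (Ms 0) \<and> pmt_equiv M' (Ms' (k - 1)) \<and>
       (\<forall>i. i + 1 < k \<longrightarrow> pmt_equiv (Ms' i) (Ms (i + 1)))}"

text \<open>Sup norm over K (with the convention that it is 0 for empty K).\<close>

definition sup_dist :: "'a set set \<Rightarrow> ('a set \<Rightarrow> real) \<Rightarrow> ('a set \<Rightarrow> real) \<Rightarrow> ereal" where
  "sup_dist K F G = Sup (insert 0 ((\<lambda>\<sigma>. ereal \<bar>F \<sigma> - G \<sigma>\<bar>) ` K))"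

end

theory Submission
  imports Defs "HOL-Computational_Algebra.Group_Closure"
begin

text \<open>
  Let \<open>\<epsilon>\<close> be the sup distance of the filters. The sublevel set of \<open>F\<close> at \<open>s\<close> lies in that of \<open>G\<close>
  at \<open>s + \<epsilon>\<close> and vice versa, so sending a component to the component containing it \<open>\<epsilon>\<close> higher up in
  the other filtration gives a pair of continuous maps satisfying the height and covering conditions.

  For the frequencies let \<open>\<Gamma> \<subseteq> \<Delta>\<close> be such components. Their preimages are locally finite unions of
  closed connected cells, so the lattice permutes the shadows of a component transitively; the
  periodicity lattice thus does not depend on the shadow, and \<open>\<Lambda>\<^sub>\<Gamma> \<subseteq> \<Lambda>\<^sub>\<Delta>\<close>. If the dimensions differ,
  the exponent of the shadow monomial drops. If they agree, the translates of a unit cell of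
  \<open>\<Lambda>\<^sub>\<Delta>\<close> by \<open>\<Lambda>\<^sub>\<Gamma>\<close> are disjoint, whereas those of a unit cell of \<open>\<Lambda>\<^sub>\<Gamma>\<close> tile the span, so the
  volume does not increase.

  The bound on \<open>J\<close> follows since every tree splinters itself.
\<close>

section \<open>Subgroups of lattices\<close>

text \<open>Additive subgroups are treated as submodules over the integers.\<close>

interpretation int_module: module "\<lambda>(k::int) (x::'a::real_vector). of_int k *\<^sub>R x"
  by unfold_locales (simp_all add: scaleR_add_right scaleR_add_left)

lemma subspace_imp_int_subspace: "subspace S \<Longrightarrow> int_module.subspace S"
  unfolding subspace_def int_module.subspace_def by blast

lemma int_subspaceI:
  assumes "0 \<in> S" and diff: "\<And>x y. x \<in> S \<Longrightarrow> y \<in> S \<Longrightarrow> x - y \<in> S"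
  shows "int_module.subspace S"
proof (rule int_module.subspaceI)
  have uminus: "- x \<in> S" if "x \<in> S" for x
    using diff[OF \<open>0 \<in> S\<close> that] by simp
  show add: "x + y \<in> S" if "x \<in> S" "y \<in> S" for x y
    using diff[OF that(1) uminus[OF that(2)]] by simp
  have "of_nat n *\<^sub>R x \<in> S" if "x \<in> S" for n x
    using that \<open>0 \<in> S\<close> add by (induction n) (simp_all add: scaleR_add_left)
  then show "of_int k *\<^sub>R x \<in> S" if "x \<in> S" for k x
    using that uminus by (cases k rule: int_cases2) simp_all
qed fact

lemma int_module_span_subset_span: "int_module.span U \<subseteq> span U"
  by (simp add: int_module.span_minimal span_superset subspace_imp_int_subspace)

lemma span_int_module_span: "span (int_module.span U) = span U"
  using int_module_span_subset_span[of U] int_module.span_superset[of U]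
  unfolding real_vector.span_eq using span_superset by blast

lemma countable_int_module_span: "finite U \<Longrightarrow> countable (int_module.span U)"
proof (induction U rule: finite_induct)
  case (insert v U)
  have "int_module.span (insert v U)
      \<subseteq> (\<lambda>(k::int, x). x + of_int k *\<^sub>R v) ` (UNIV \<times> int_module.span U)"
    unfolding int_module.span_insert by (force simp: image_iff)
  then show ?case by (rule countable_subset) (use insert.IH in simp)
qed simp

lemma int_span_eq_int_module_span: "finite U \<Longrightarrow> int_span U = int_module.span U"
  unfolding int_span_def int_module.span_finite by blast

lemma is_lattice_iff:
  "is_lattice L \<longleftrightarrow> (\<exists>U. finite U \<and> independent U \<and> L = int_module.span U)"
  unfolding is_lattice_def using int_span_eq_int_module_span by metis

lemma int_subspace_lattice: "is_lattice L \<Longrightarrow> int_module.subspace L"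
  unfolding is_lattice_iff by auto

lemma int_subgroup_principal:
  fixes H :: "int set"
  assumes "0 \<in> H" "\<And>k l. k \<in> H \<Longrightarrow> l \<in> H \<Longrightarrow> k - l \<in> H"
  shows "H = range ((*) (Gcd H))"
proof -
  have "k \<in> H" if "k \<in> group_closure H" for k
    using that by induction (use assms in auto)
  then have "group_closure H = H" by (auto intro: group_closure.base)
  then show ?thesis using group_closure_eq by metis
qed

lemma int_subspace_coefficients_principal:
  assumes "int_module.subspace P"
  obtains n where "{k. \<exists>y\<in>P. y - of_int k *\<^sub>R v \<in> int_module.span U} = range ((*) n)"
proof -
  define H where "H = {k. \<exists>y\<in>P. y - of_int k *\<^sub>R v \<in> int_module.span U}"
  have "0 \<in> H"
    unfolding H_def using int_module.subspace_0[OF assms] int_module.span_zero by force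
  moreover have "k - l \<in> H" if kl: "k \<in> H" "l \<in> H" for k l
  proof -
    obtain x y where "x \<in> P" "x - of_int k *\<^sub>R v \<in> int_module.span U"
        "y \<in> P" "y - of_int l *\<^sub>R v \<in> int_module.span U"
      using kl unfolding H_def by blast
    then have "x - y \<in> P" "(x - of_int k *\<^sub>R v) - (y - of_int l *\<^sub>R v) \<in> int_module.span U"
      using int_module.subspace_diff[OF assms] int_module.span_diff by blast+
    then show ?thesis
      unfolding H_def by (auto simp: algebra_simps intro!: bexI[of _ "x - y"])
  qed
  ultimately have "H = range ((*) (Gcd H))" by (rule int_subgroup_principal)
  then show ?thesis using that unfolding H_def by blast
qed

text \<open>The element \<open>w\<close> is chosen such that its coefficient along \<open>v\<close> generates the group of all
  such coefficients of elements of \<open>P\<close>.\<close>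

lemma int_subspace_cyclic_modulo_span:
  assumes P: "int_module.subspace P" "P \<subseteq> int_module.span (insert v U)"
  obtains w n where "w \<in> P" "w - of_int n *\<^sub>R v \<in> int_module.span U"
    "P = int_module.span (insert w (P \<inter> int_module.span U))"
proof -
  obtain n where n: "{k. \<exists>y\<in>P. y - of_int k *\<^sub>R v \<in> int_module.span U} = range ((*) n)"
    using int_subspace_coefficients_principal[OF P(1)] .
  moreover have "n \<in> range ((*) n)" by (metis mult.right_neutral rangeI)
  ultimately obtain w where w: "w \<in> P" "w - of_int n *\<^sub>R v \<in> int_module.span U" by blast
  have "y \<in> int_module.span (insert w (P \<inter> int_module.span U))" if y: "y \<in> P" for y
  proof -
    obtain k where k: "y - of_int k *\<^sub>R v \<in> int_module.span U"
      using y P(2) int_module.span_breakdown_eq by blast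
    then obtain q where "k = n * q" using y n by blast
    then have diff: "y - of_int q *\<^sub>R w
        = (y - of_int k *\<^sub>R v) - of_int q *\<^sub>R (w - of_int n *\<^sub>R v)"
      by (simp add: algebra_simps)
    have "y - of_int q *\<^sub>R w \<in> int_module.span U"
      unfolding diff by (rule int_module.span_diff[OF k int_module.span_scale[OF w(2)]])
    moreover have "y - of_int q *\<^sub>R w \<in> P"
      using y w(1) P(1) by (intro int_module.subspace_diff int_module.subspace_scale)
    ultimately show ?thesis
      using int_module.span_base int_module.span_breakdown_eq by blast
  qed
  moreover have "int_module.span (insert w (P \<inter> int_module.span U)) \<subseteq> P"
    using w(1) P(1) by (intro int_module.span_minimal) auto
  ultimately show ?thesis using that[OF w] by blast
qed

lemma int_subspace_basis_extend:
  assumes "v \<notin> span U" and P: "int_module.subspace P" "P \<subseteq> int_module.span (insert v U)"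
    and B: "finite B" "independent B" "P \<inter> int_module.span U = int_module.span B"
  shows "\<exists>C. finite C \<and> independent C \<and> P = int_module.span C"
proof -
  obtain w n where w: "w \<in> P" "w - of_int n *\<^sub>R v \<in> int_module.span U"
      and "P = int_module.span (insert w (int_module.span B))"
    using int_subspace_cyclic_modulo_span[OF P] B(3) by metis
  then have span_insert: "P = int_module.span (insert w B)"
    by (simp only: int_module.span_insert int_module.span_span)
  show ?thesis
  proof (cases "n = 0")
    case True
    then have "w \<in> int_module.span B" using w B(3) by auto
    then have "int_module.span (insert w B) = int_module.span B"
      using int_module.span_superset int_module.span_mono[of B "insert w B"]
      unfolding int_module.span_eq by blast
    then show ?thesis using span_insert B(1,2) by blast
  next
    case False
    have "w \<notin> span U"
    proof
      assume "w \<in> span U"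
      then have "w - (w - of_int n *\<^sub>R v) \<in> span U"
        using w(2) int_module_span_subset_span by (blast intro: span_diff)
      then have "of_int n *\<^sub>R v \<in> span U" by simp
      then have "(1 / of_int n) *\<^sub>R of_int n *\<^sub>R v \<in> span U" by (rule span_scale)
      then show False using False \<open>v \<notin> span U\<close> by simp
    qed
    moreover have "B \<subseteq> span U"
      using B(3) int_module.span_superset[of B] int_module_span_subset_span by blast
    ultimately have "w \<notin> span B" using span_minimal[OF _ subspace_span] by blast
    then have "independent (insert w B)" using B(2) by (simp add: independent_insertI)
    then show ?thesis using span_insert B(1) by (metis finite_insert)
  qed
qed

lemma int_subspace_has_basis:
  assumes "finite U" "independent U" "int_module.subspace P" "P \<subseteq> int_module.span U"
  shows "\<exists>B. finite B \<and> independent B \<and> P = int_module.span B"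
  using assms
proof (induction U arbitrary: P rule: finite_induct)
  case empty
  then have "P = int_module.span {}" using int_module.subspace_0 by auto
  then show ?case using independent_empty by blast
next
  case (insert v U)
  have "v \<notin> span U" "independent U"
    using insert.prems(1) insert.hyps(2) by (auto simp: independent_insert)
  moreover have "int_module.subspace (P \<inter> int_module.span U)"
    using insert.prems(2) by (simp add: int_module.subspace_inter)
  ultimately obtain B where "finite B" "independent B" "P \<inter> int_module.span U = int_module.span B"
    using insert.IH[of "P \<inter> int_module.span U"] by auto
  then show ?case
    using int_subspace_basis_extend[OF \<open>v \<notin> span U\<close> insert.prems(2,3)] by blast
qed

lemma is_lattice_int_subspace:
  assumes "is_lattice L" "int_module.subspace P" "P \<subseteq> L"
  shows "is_lattice P"
  using assms int_subspace_has_basis unfolding is_lattice_iff by blast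

section \<open>Unit cells\<close>

lemma independent_dual_functionals:
  fixes U :: "'a::real_vector set"
  assumes "finite U" "independent U"
  obtains g :: "'a \<Rightarrow> 'a \<Rightarrow> real"
  where "\<And>u. linear (g u)" "\<And>c u. u \<in> U \<Longrightarrow> g u (\<Sum>v\<in>U. c v *\<^sub>R v) = c u"
proof -
  have "\<exists>f. linear f \<and> (\<forall>v\<in>U. f v = (if v = u then 1 else 0 :: real))" for u
    using assms(2) by (rule linear_independent_extend)
  then obtain g where g: "\<And>u. linear (g u)" "\<And>u v. v \<in> U \<Longrightarrow> g u v = (if v = u then 1 else 0 :: real)"
    by metis
  have "g u (\<Sum>v\<in>U. c v *\<^sub>R v) = c u" if "u \<in> U" for c u
  proof -
    have "g u (\<Sum>v\<in>U. c v *\<^sub>R v) = (\<Sum>v\<in>U. c v * g u v)"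
      by (simp add: linear_sum[OF g(1)] linear_scale[OF g(1)])
    also have "\<dots> = (\<Sum>v\<in>U. if v = u then c v else 0)"
      using g(2) by (intro sum.cong) auto
    also have "\<dots> = c u" using that assms(1) by simp
    finally show ?thesis .
  qed
  then show ?thesis using that g(1) by blast
qed

lemma unit_cell_subset_span: "unit_cell U \<subseteq> span U"
  unfolding unit_cell_def by (auto intro: span_sum span_scale span_base)

lemma bounded_unit_cell: "bounded (unit_cell U)"
proof (rule boundedI)
  fix x assume "x \<in> unit_cell U"
  then obtain c where x: "x = (\<Sum>u\<in>U. c u *\<^sub>R u)" and c: "\<And>u. u \<in> U \<Longrightarrow> 0 \<le> c u \<and> c u < 1"
    unfolding unit_cell_def by blast
  have "norm (c u *\<^sub>R u) \<le> norm u" if "u \<in> U" for u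
    using c[OF that] mult_left_le_one_le[of "norm u" "c u"] by auto
  then show "norm x \<le> (\<Sum>u\<in>U. norm u)"
    unfolding x by (intro order_trans[OF norm_sum] sum_mono)
qed

lemma unit_cell_borel:
  fixes U :: "'a::euclidean_space set"
  assumes "finite U" "independent U"
  shows "unit_cell U \<in> sets borel"
proof -
  obtain g :: "'a \<Rightarrow> 'a \<Rightarrow> real" where g: "\<And>u. linear (g u)"
      and dual: "\<And>c u. u \<in> U \<Longrightarrow> g u (\<Sum>v\<in>U. c v *\<^sub>R v) = c u"
    using independent_dual_functionals[OF assms] by metis
  have "unit_cell U = span U \<inter> {x. \<forall>u\<in>U. 0 \<le> g u x \<and> g u x < 1}"
  proof (intro equalityI subsetI)
    fix x assume "x \<in> unit_cell U"
    then show "x \<in> span U \<inter> {x. \<forall>u\<in>U. 0 \<le> g u x \<and> g u x < 1}"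
      using unit_cell_subset_span dual unfolding unit_cell_def by auto
  next
    fix x assume x: "x \<in> span U \<inter> {x. \<forall>u\<in>U. 0 \<le> g u x \<and> g u x < 1}"
    then obtain c where "x = (\<Sum>u\<in>U. c u *\<^sub>R u)" using span_finite[OF assms(1)] by auto
    then show "x \<in> unit_cell U" using x dual unfolding unit_cell_def by auto
  qed
  moreover have "span U \<in> sets borel"
    by (simp add: borel_closed closed_subspace)
  moreover have "g u \<in> borel_measurable borel" for u
    using g
    by (intro borel_measurable_continuous_onI linear_continuous_on linear_linear[THEN iffD2])
  then have "{x. \<forall>u\<in>U. 0 \<le> g u x \<and> g u x < 1} \<in> sets borel"
    using assms(1) by measurable
  ultimately show ?thesis by simp
qed

lemma span_eq_Union_unit_cell_translates:
  assumes "finite U"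
  shows "span U = (\<Union>w\<in>int_module.span U. (+) w ` unit_cell U)"
proof
  show "span U \<subseteq> (\<Union>w\<in>int_module.span U. (+) w ` unit_cell U)"
  proof
    fix x assume "x \<in> span U"
    then obtain c where "x = (\<Sum>u\<in>U. c u *\<^sub>R u)" using span_finite[OF assms] by auto
    then have "x = (\<Sum>u\<in>U. of_int \<lfloor>c u\<rfloor> *\<^sub>R u) + (\<Sum>u\<in>U. frac (c u) *\<^sub>R u)"
      by (simp add: frac_def scaleR_diff_left sum_subtractf)
    moreover have "(\<Sum>u\<in>U. of_int \<lfloor>c u\<rfloor> *\<^sub>R u) \<in> int_module.span U"
      by (intro int_module.span_sum int_module.span_scale int_module.span_base)
    moreover have "(\<Sum>u\<in>U. frac (c u) *\<^sub>R u) \<in> unit_cell U"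
      unfolding unit_cell_def
      by (intro CollectI exI[of _ "\<lambda>u. frac (c u)"]) (simp add: frac_lt_1)
    ultimately show "x \<in> (\<Union>w\<in>int_module.span U. (+) w ` unit_cell U)" by blast
  qed
  show "(\<Union>w\<in>int_module.span U. (+) w ` unit_cell U) \<subseteq> span U"
    using unit_cell_subset_span int_module_span_subset_span by (blast intro: span_add)
qed

lemma disjoint_unit_cell_translates:
  fixes U :: "'a::euclidean_space set"
  assumes "finite U" "independent U"
  shows "disjoint_family_on (\<lambda>w. (+) w ` unit_cell U) (int_module.span U)"
  unfolding disjoint_family_on_def
proof (intro ballI impI, rule ccontr)
  fix v w assume "v \<in> int_module.span U" "w \<in> int_module.span U" "v \<noteq> w"
  then obtain k l where k: "v = (\<Sum>u\<in>U. of_int (k u) *\<^sub>R u)" and l: "w = (\<Sum>u\<in>U. of_int (l u) *\<^sub>R u)"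
    using int_module.span_finite[OF assms(1)] by blast
  assume "(+) v ` unit_cell U \<inter> (+) w ` unit_cell U \<noteq> {}"
  then obtain x y where "x \<in> unit_cell U" "y \<in> unit_cell U" "v + x = w + y" by auto
  then obtain c d where c: "x = (\<Sum>u\<in>U. c u *\<^sub>R u)" "\<And>u. u \<in> U \<Longrightarrow> 0 \<le> c u \<and> c u < 1"
      and d: "y = (\<Sum>u\<in>U. d u *\<^sub>R u)" "\<And>u. u \<in> U \<Longrightarrow> 0 \<le> d u \<and> d u < 1"
    unfolding unit_cell_def by blast
  have sums_eq: "(\<Sum>u\<in>U. (of_int (k u) + c u) *\<^sub>R u) = (\<Sum>u\<in>U. (of_int (l u) + d u) *\<^sub>R u)"
    using \<open>v + x = w + y\<close> unfolding k l c(1) d(1) by (simp add: scaleR_add_left sum.distrib)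
  obtain g :: "'a \<Rightarrow> 'a \<Rightarrow> real"
    where dual: "\<And>c u. u \<in> U \<Longrightarrow> g u (\<Sum>v\<in>U. c v *\<^sub>R v) = c u"
    using independent_dual_functionals[OF assms] by metis
  have coords_eq: "of_int (k u) + c u = of_int (l u) + d u" if "u \<in> U" for u
    using arg_cong[OF sums_eq, of "g u"] unfolding dual[OF that] .
  have "k u = l u" if "u \<in> U" for u
    using that[THEN c(2)] that[THEN d(2)] coords_eq[OF that] by linarith
  then have "v = w" unfolding k l by simp
  then show False using \<open>v \<noteq> w\<close> by simp
qed

section \<open>Monotonicity of the lattice volume\<close>

lemma (in product_sigma_finite) distr_PiM_componentwise:
  assumes "finite I"
    and T: "\<And>i. i \<in> I \<Longrightarrow> T i \<in> measurable (M i) (M i)" "\<And>i. i \<in> I \<Longrightarrow> distr (M i) (M i) (T i) = M i"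
  shows "distr (PiM I M) (PiM I M) (\<lambda>f. \<lambda>i\<in>I. T i (f i)) = PiM I M"
proof (rule PiM_eqI)
  let ?T = "\<lambda>f. \<lambda>i\<in>I. T i (f i)"
  fix A assume A: "\<And>i. i \<in> I \<Longrightarrow> A i \<in> sets (M i)"
  define B where "B i = T i -` A i \<inter> space (M i)" for i
  have B: "B i \<in> sets (M i)" if "i \<in> I" for i
    unfolding B_def using T(1) A that by (blast intro: measurable_sets)
  have "?T \<in> measurable (PiM I M) (PiM I M)"
    by (intro measurable_restrict)
      (simp add: T(1) measurable_compose[OF measurable_component_singleton])
  then have "emeasure (distr (PiM I M) (PiM I M) ?T) (Pi\<^sub>E I A)
      = emeasure (PiM I M) (?T -` Pi\<^sub>E I A \<inter> space (PiM I M))"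
    using assms(1) A by (intro emeasure_distr sets_PiM_I_finite)
  also have "?T -` Pi\<^sub>E I A \<inter> space (PiM I M) = Pi\<^sub>E I B"
    by (auto simp: space_PiM PiE_iff B_def)
  also have "emeasure (PiM I M) (Pi\<^sub>E I B) = (\<Prod>i\<in>I. emeasure (M i) (B i))"
    using assms(1) B by (rule emeasure_PiM)
  also have "\<dots> = (\<Prod>i\<in>I. emeasure (M i) (A i))"
  proof (intro prod.cong refl)
    fix i assume i: "i \<in> I"
    have "emeasure (M i) (B i) = emeasure (distr (M i) (M i) (T i)) (A i)"
      unfolding B_def using T(1)[OF i] A[OF i] by (rule emeasure_distr[symmetric])
    then show "emeasure (M i) (B i) = emeasure (M i) (A i)" by (simp only: T(2)[OF i])
  qed
  finally show "emeasure (distr (PiM I M) (PiM I M) ?T) (Pi\<^sub>E I A) = (\<Prod>i\<in>I. emeasure (M i) (A i))" .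
qed (use assms(1) in simp_all)

lemma translation_invariant_measure_image:
  fixes M :: "'a::real_normed_vector measure"
  assumes M: "sets M = sets borel" "distr M borel ((+) w) = M" and A: "A \<in> sets borel"
  shows "(+) w ` A \<in> sets borel" "emeasure M ((+) w ` A) = emeasure M A"
proof -
  have "(+) w ` A = (\<lambda>x. x - w) -` A \<inter> space borel"
    by (auto intro: image_eqI[of _ _ "_ - w"])
  moreover have "(\<lambda>x. x - w) \<in> borel_measurable (borel :: 'a measure)"
    by (intro borel_measurable_continuous_onI continuous_intros)
  ultimately show image: "(+) w ` A \<in> sets borel" using A by (simp only: measurable_sets)
  have "(+) w \<in> measurable M borel"
    unfolding measurable_cong_sets[OF M(1) refl]
    by (intro borel_measurable_continuous_onI continuous_intros)
  then have "emeasure (distr M borel ((+) w)) ((+) w ` A)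
      = emeasure M ((+) w -` (+) w ` A \<inter> space M)"
    using image by (rule emeasure_distr)
  also have "(+) w -` (+) w ` A \<inter> space M = A"
    using sets_eq_imp_space_eq[OF M(1)] by (simp add: inj_vimage_image_eq)
  finally show "emeasure M ((+) w ` A) = emeasure M A" unfolding M(2) .
qed

text \<open>Cut the packing set \<open>E\<close> into the pieces lying in the single tiles and translate them all
  into \<open>D\<close>.\<close>

lemma emeasure_packing_le_tiling:
  fixes M :: "'a::real_normed_vector measure"
  assumes "countable I" and D: "D \<in> sets borel" and E: "E \<in> sets borel" and M: "sets M = sets borel"
    and invariant: "\<And>w. w \<in> I \<Longrightarrow> distr M borel ((+) w) = M"
    and tiling: "disjoint_family_on (\<lambda>w. (+) w ` D) I" "E \<subseteq> (\<Union>w\<in>I. (+) w ` D)"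
    and packing: "disjoint_family_on (\<lambda>w. (+) w ` E) I"
  shows "emeasure M E \<le> emeasure M D"
proof -
  define part where "part w = D \<inter> (+) w -` E" for w
  have "(+) w -` E \<inter> space borel \<in> sets borel" for w :: 'a
    using E
    by (intro measurable_sets[of _ borel borel] borel_measurable_continuous_onI continuous_intros)
  then have part: "part w \<in> sets borel" for w
    unfolding part_def using D by simp
  note part_image = translation_invariant_measure_image[OF M invariant part]
  have "E = (\<Union>w\<in>I. (+) w ` part w)" unfolding part_def using tiling(2) by fastforce
  then have "emeasure M E = emeasure M (\<Union>w\<in>I. (+) w ` part w)" by (rule arg_cong)
  also have "\<dots> = (\<integral>\<^sup>+w. emeasure M ((+) w ` part w) \<partial>count_space I)"
  proof (rule emeasure_UN_countable)
    show "disjoint_family_on (\<lambda>w. (+) w ` part w) I"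
      using tiling(1) unfolding disjoint_family_on_def part_def by blast
  qed (use part_image \<open>countable I\<close> M in simp_all)
  also have "\<dots> = (\<integral>\<^sup>+w. emeasure M (part w) \<partial>count_space I)"
    by (intro nn_integral_cong) (simp add: part_image)
  also have "\<dots> = emeasure M (\<Union>w\<in>I. part w)"
  proof (rule emeasure_UN_countable[symmetric])
    have "v = w" if "v \<in> I" "w \<in> I" "x \<in> part v" "x \<in> part w" for v w x
    proof -
      have "v + x \<in> E" "w + x \<in> E" using that by (simp_all add: part_def)
      then have "w + v + x \<in> (+) v ` E \<inter> (+) w ` E" by (force simp: algebra_simps)
      then show ?thesis using packing that unfolding disjoint_family_on_def by blast
    qed
    then show "disjoint_family_on part I" unfolding disjoint_family_on_def by blast
  qed (use part \<open>countable I\<close> M in simp_all)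
  also have "\<dots> \<le> emeasure M D"
    using D M by (intro emeasure_mono) (auto simp: part_def)
  finally show ?thesis .
qed

interpretation lborel_product: product_sigma_finite "\<lambda>_. lborel :: real measure"
  by (rule product_sigma_finite.intro) (rule sigma_finite_lborel)

locale orthonormal_sequence =
  fixes b :: "nat \<Rightarrow> 'a::euclidean_space" and p :: nat
  assumes inner_eq: "\<And>i j. i < p \<Longrightarrow> j < p \<Longrightarrow> b i \<bullet> b j = (if i = j then 1 else 0)"
begin

abbreviation coord_measure :: "(nat \<Rightarrow> real) measure" where
  "coord_measure \<equiv> PiM {..<p} (\<lambda>_. lborel)"

definition lincomb :: "(nat \<Rightarrow> real) \<Rightarrow> 'a" where
  "lincomb f = (\<Sum>i<p. f i *\<^sub>R b i)"

definition coords :: "'a \<Rightarrow> nat \<Rightarrow> real" where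
  "coords x = (\<lambda>i\<in>{..<p}. x \<bullet> b i)"

definition lborel_span :: "'a measure" where
  "lborel_span = distr coord_measure borel lincomb"

lemma sets_lborel_span: "sets lborel_span = sets borel"
  by (simp add: lborel_span_def)

lemma lincomb_measurable: "lincomb \<in> measurable coord_measure borel"
  unfolding lincomb_def by measurable

lemma emeasure_lborel_span:
  "A \<in> sets borel \<Longrightarrow>
     emeasure lborel_span A = emeasure coord_measure (lincomb -` A \<inter> space coord_measure)"
  unfolding lborel_span_def by (rule emeasure_distr[OF lincomb_measurable])

lemma inner_lincomb: "i < p \<Longrightarrow> lincomb f \<bullet> b i = f i"
  by (simp add: lincomb_def inner_sum_left inner_eq if_distrib sum.delta cong: if_cong)

lemma coords_lincomb: "f \<in> extensional {..<p} \<Longrightarrow> coords (lincomb f) = f"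
  unfolding coords_def by (rule extensionalityI[of _ "{..<p}"]) (simp_all add: inner_lincomb)

lemma lincomb_coords:
  assumes "x \<in> span (b ` {..<p})"
  shows "lincomb (coords x) = x"
proof -
  have "linear (\<lambda>x. lincomb (coords x))"
    unfolding lincomb_def coords_def
    by (rule linearI) (simp_all add: inner_add_left scaleR_add_left sum.distrib scaleR_sum_right)
  moreover have "lincomb (coords (b k)) = b k" if "k < p" for k
    using that unfolding lincomb_def coords_def
    by (simp add: inner_eq if_distrib[of "\<lambda>c. c *\<^sub>R _"] sum.delta cong: if_cong)
  ultimately show ?thesis
    using linear_eq_on_span[of "\<lambda>x. lincomb (coords x)" id "b ` {..<p}" x] assms linear_id by auto
qed

lemma coords_image_eq_vimage:
  assumes "A \<subseteq> span (b ` {..<p})"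
  shows "coords ` A = lincomb -` A \<inter> space coord_measure"
proof (intro equalityI subsetI)
  have "coords x \<in> space coord_measure" for x
    by (simp add: coords_def space_PiM)
  moreover fix f assume "f \<in> coords ` A"
  ultimately show "f \<in> lincomb -` A \<inter> space coord_measure"
    using assms lincomb_coords by auto
next
  fix f assume "f \<in> lincomb -` A \<inter> space coord_measure"
  then show "f \<in> coords ` A"
    by (intro image_eqI[of _ coords "lincomb f"]) (simp_all add: space_PiM PiE_iff coords_lincomb)
qed

lemma distr_lborel_span_plus:
  assumes "w \<in> span (b ` {..<p})"
  shows "distr lborel_span borel ((+) w) = lborel_span"
proof -
  let ?T = "\<lambda>f. \<lambda>i\<in>{..<p}. coords w i + f i"
  have T: "?T \<in> measurable coord_measure coord_measure"
    by (intro measurable_restrict) simp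
  have "distr coord_measure coord_measure ?T = coord_measure"
    by (rule lborel_product.distr_PiM_componentwise)
      (simp_all add: lborel_distr_plus cong: distr_cong)
  then have "lborel_span = distr (distr coord_measure coord_measure ?T) borel lincomb"
    by (simp add: lborel_span_def)
  also have "\<dots> = distr coord_measure borel (lincomb \<circ> ?T)"
    by (rule distr_distr[OF lincomb_measurable T])
  also have "lincomb \<circ> ?T = (+) w \<circ> lincomb"
    using lincomb_coords[OF assms]
    by (auto simp: fun_eq_iff lincomb_def scaleR_add_left sum.distrib)
  also have "distr coord_measure borel \<dots> = distr lborel_span borel ((+) w)"
    unfolding lborel_span_def by (rule distr_distr[symmetric, OF _ lincomb_measurable]) simp
  finally show ?thesis by (rule sym)
qed

lemma emeasure_lborel_span_finite:
  assumes "bounded A" "A \<in> sets borel"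
  shows "emeasure lborel_span A < \<infinity>"
proof -
  obtain r where r: "\<And>x. x \<in> A \<Longrightarrow> norm x \<le> r" using assms(1) bounded_iff by blast
  have "\<bar>f i\<bar> \<le> r" if "lincomb f \<in> A" "i < p" for f i
  proof -
    have "norm (b i) = 1" using inner_eq[OF that(2,2)] by (simp add: norm_eq_1)
    then have "\<bar>f i\<bar> \<le> norm (lincomb f)"
      using Cauchy_Schwarz_ineq2[of "lincomb f" "b i"] that(2) by (simp add: inner_lincomb)
    then show ?thesis using r[OF that(1)] by simp
  qed
  then have "lincomb -` A \<inter> space coord_measure \<subseteq> Pi\<^sub>E {..<p} (\<lambda>_. {-r..r})"
    by (auto simp: space_PiM PiE_iff abs_le_iff minus_le_iff)
  then have "emeasure lborel_span A \<le> emeasure coord_measure (Pi\<^sub>E {..<p} (\<lambda>_. {-r..r}))"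
    unfolding emeasure_lborel_span[OF assms(2)]
    by (intro emeasure_mono sets_PiM_I_finite) auto
  also have "\<dots> = (\<Prod>i<p. emeasure lborel {-r..r})"
    by (rule lborel_product.emeasure_PiM) auto
  also have "\<dots> < \<infinity>" by (simp add: emeasure_lborel_Icc_eq ennreal_power power_less_top_ennreal)
  finally show ?thesis .
qed

end

lemma exists_orthonormal_sequence:
  fixes V :: "'a::euclidean_space set"
  assumes "subspace V"
  shows "\<exists>b :: nat \<Rightarrow> 'a. orthonormal_sequence b (dim V) \<and> span (b ` {..<dim V}) = V"
proof -
  obtain B where B: "pairwise orthogonal B" "\<And>x. x \<in> B \<Longrightarrow> norm x = 1"
      "independent B" "card B = dim V" "span B = V"
    using orthonormal_basis_subspace[OF assms] by metis
  then obtain b where b: "bij_betw b {..<dim V} B"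
    using ex_bij_betw_nat_finite[of B] independent_imp_finite by (auto simp: atLeast0LessThan)
  have "orthonormal_sequence b (dim V)"
  proof
    fix i j assume i: "i < dim V" and j: "j < dim V"
    show "b i \<bullet> b j = (if i = j then 1 else 0)"
    proof (cases "i = j")
      case True
      then show ?thesis using B(2) bij_betwE[OF b] i by (simp add: norm_eq_1)
    next
      case False
      then have "b i \<noteq> b j" using b i j by (auto simp: bij_betw_def inj_on_def)
      then show ?thesis
        using False B(1) bij_betwE[OF b] i j by (auto simp: pairwise_def orthogonal_def)
    qed
  qed
  moreover have "span (b ` {..<dim V}) = V" using b B(5) by (simp add: bij_betw_def)
  ultimately show ?thesis by blast
qed

lemma pvol_eq_measure_lborel_span:
  fixes V :: "'a::euclidean_space set"
  assumes "subspace V" "dim V = p"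
  obtains b where "orthonormal_sequence b p" "span (b ` {..<p}) = V"
    "\<And>A. A \<in> sets borel \<Longrightarrow> A \<subseteq> V \<Longrightarrow> pvol p V A = measure (orthonormal_sequence.lborel_span b p) A"
proof -
  define b where "b = (SOME b :: nat \<Rightarrow> 'a. (\<forall>i<p. \<forall>j<p. b i \<bullet> b j = (if i = j then 1 else 0))
      \<and> span (b ` {..<p}) = V)"
  have "\<exists>b :: nat \<Rightarrow> 'a. (\<forall>i<p. \<forall>j<p. b i \<bullet> b j = (if i = j then 1 else 0)) \<and> span (b ` {..<p}) = V"
    using exists_orthonormal_sequence[OF assms(1)]
    unfolding orthonormal_sequence_def assms(2) by blast
  from someI_ex[OF this] have b: "orthonormal_sequence b p" "span (b ` {..<p}) = V"
    unfolding b_def[symmetric] orthonormal_sequence_def by blast+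
  interpret orthonormal_sequence b p by fact
  have "pvol p V A = measure lborel_span A" if A: "A \<in> sets borel" "A \<subseteq> V" for A
  proof -
    have "pvol p V A = measure coord_measure (coords ` A)"
      unfolding pvol_def Let_def b_def[symmetric] coords_def ..
    then show ?thesis
      using coords_image_eq_vimage A(2) b(2) emeasure_lborel_span[OF A(1)]
      by (simp add: measure_def)
  qed
  then show ?thesis using that b by blast
qed

lemma pvol_unit_cell_antimono:
  fixes U W :: "'a::euclidean_space set"
  assumes U: "finite U" "independent U" and W: "finite W" "independent W"
    and "int_module.span U \<subseteq> int_module.span W" "span U = span W"
  shows "pvol (dim U) (span U) (unit_cell W) \<le> pvol (dim U) (span U) (unit_cell U)"
proof -
  obtain b where "orthonormal_sequence b (dim U)" and b: "span (b ` {..<dim U}) = span U"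
    and pvol: "\<And>A. A \<in> sets borel \<Longrightarrow> A \<subseteq> span U \<Longrightarrow>
       pvol (dim U) (span U) A = measure (orthonormal_sequence.lborel_span b (dim U)) A"
    using pvol_eq_measure_lborel_span[OF subspace_span dim_span] by metis
  then interpret orthonormal_sequence b "dim U" by simp
  have "emeasure lborel_span (unit_cell W) \<le> emeasure lborel_span (unit_cell U)"
  proof (rule emeasure_packing_le_tiling)
    show "countable (int_module.span U)" using U(1) by (rule countable_int_module_span)
    show "distr lborel_span borel ((+) w) = lborel_span" if "w \<in> int_module.span U" for w
      using that b int_module_span_subset_span by (intro distr_lborel_span_plus) auto
    show "unit_cell W \<subseteq> (\<Union>w\<in>int_module.span U. (+) w ` unit_cell U)"
      using unit_cell_subset_span[of W] span_eq_Union_unit_cell_translates[OF U(1)] assms(6) by simp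
    show "disjoint_family_on (\<lambda>w. (+) w ` unit_cell W) (int_module.span U)"
      using assms(5) disjoint_unit_cell_translates[OF W] by (rule disjoint_family_on_mono)
  qed (use U W in \<open>simp_all add: sets_lborel_span unit_cell_borel disjoint_unit_cell_translates\<close>)
  then have "measure lborel_span (unit_cell W) \<le> measure lborel_span (unit_cell U)"
    unfolding measure_def
    using emeasure_lborel_span_finite bounded_unit_cell unit_cell_borel[OF U]
    by (intro enn2real_mono) auto
  then show ?thesis
    using pvol unit_cell_borel[OF U] unit_cell_borel[OF W] unit_cell_subset_span assms(6) by metis
qed

lemma lattice_vol_eq_pvol:
  fixes P :: "'a::euclidean_space set"
  assumes "is_lattice P"
  obtains U where "finite U" "independent U" "P = int_module.span U"
    "lattice_vol P = pvol (dim P) (span P) (unit_cell U)"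
proof -
  define U where "U = (SOME U. finite U \<and> independent U \<and> P = int_span U)"
  have "finite U \<and> independent U \<and> P = int_span U"
    unfolding U_def by (rule someI_ex) (use assms is_lattice_def in blast)
  then have U: "finite U" "independent U" "P = int_module.span U"
    by (auto simp: int_span_eq_int_module_span)
  have span: "span P = span U" unfolding U(3) by (rule span_int_module_span)
  then have "dim P = card U" using U(2) dim_eq_card by metis
  then have "lattice_vol P = pvol (dim P) (span P) (unit_cell U)"
    unfolding lattice_vol_def Let_def U_def[symmetric] span by simp
  then show ?thesis using that U by blast
qed

lemma lattice_vol_antimono:
  fixes P Q :: "'a::euclidean_space set"
  assumes "is_lattice P" "is_lattice Q" "P \<subseteq> Q" "lattice_dim P = lattice_dim Q"
  shows "lattice_vol Q \<le> lattice_vol P"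
proof -
  obtain U where U: "finite U" "independent U" "P = int_module.span U"
      "lattice_vol P = pvol (dim P) (span P) (unit_cell U)"
    using lattice_vol_eq_pvol[OF assms(1)] .
  obtain W where W: "finite W" "independent W" "Q = int_module.span W"
      "lattice_vol Q = pvol (dim Q) (span Q) (unit_cell W)"
    using lattice_vol_eq_pvol[OF assms(2)] .
  have "span P = span Q"
    using assms(3,4) span_mono[OF assms(3)] subspace_dim_equal[of "span P" "span Q"]
    by (simp add: lattice_dim_def)
  then have "span U = span W"
    unfolding U(3) W(3) span_int_module_span .
  moreover have "dim P = dim U"
    unfolding U(3) by (metis dim_span span_int_module_span)
  ultimately show ?thesis
    using pvol_unit_cell_antimono[OF U(1,2) W(1,2)] assms(3,4) U(3,4) W(3,4)
    by (simp add: lattice_dim_def span_int_module_span)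
qed

section \<open>Shadows and periodicity lattices\<close>

lemma quotient_map_qtop: "quotient_map X (qtop X f) f"
proof -
  have "{x \<in> topspace X. f x \<in> f ` topspace X} = topspace X" by auto
  then have "openin (qtop X f) (f ` topspace X)" unfolding openin_qtop by simp
  then have "topspace (qtop X f) = f ` topspace X"
    using openin_subset[of "qtop X f" "f ` topspace X"] openin_topspace[of "qtop X f"]
    unfolding openin_qtop by blast
  then show ?thesis unfolding quotient_map_def openin_qtop by simp
qed

lemma topspace_qtop: "topspace (qtop X f) = f ` topspace X"
  using quotient_map_qtop[of X f] by (simp add: quotient_map_def)

lemma topspace_torus_top: "topspace (torus_top L) = range (tproj L)"
  unfolding torus_top_def topspace_qtop by simp

lemma quotient_map_tproj: "quotient_map euclidean (torus_top L) (tproj L)"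
  unfolding torus_top_def by (rule quotient_map_qtop)

lemma tproj_eq_iff:
  assumes L: "int_module.subspace L"
  shows "tproj L x = tproj L y \<longleftrightarrow> y - x \<in> L"
proof
  assume "tproj L x = tproj L y"
  moreover have "y \<in> tproj L y"
    using int_module.subspace_0[OF L] by (force simp: tproj_def)
  ultimately have "y \<in> tproj L x" by simp
  then show "y - x \<in> L" by (auto simp: tproj_def)
next
  have tproj_mono: "tproj L x \<subseteq> tproj L y" if "x - y \<in> L" for x y
  proof
    fix z assume "z \<in> tproj L x"
    then obtain u where "u \<in> L" "z = x + u" by (auto simp: tproj_def)
    then have "z = y + (x - y + u)" "x - y + u \<in> L"
      using int_module.subspace_add[OF L that] by simp_all
    then show "z \<in> tproj L y" unfolding tproj_def by blast
  qed
  assume "y - x \<in> L"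
  moreover from this have "x - y \<in> L" using int_module.subspace_neg[OF L] by fastforce
  ultimately show "tproj L x = tproj L y" using tproj_mono by blast
qed

lemma tproj_add: "int_module.subspace L \<Longrightarrow> u \<in> L \<Longrightarrow> tproj L (x + u) = tproj L x"
  by (metis add_diff_cancel_left' tproj_eq_iff)

lemma closedin_tproj_image:
  assumes "int_module.subspace L" "closed S" "\<And>x u. x \<in> S \<Longrightarrow> u \<in> L \<Longrightarrow> x + u \<in> S"
  shows "closedin (torus_top L) (tproj L ` S)"
proof -
  have "y \<in> S" if "tproj L x = tproj L y" "x \<in> S" for x y
    using assms(3)[OF that(2), of "y - x"] that(1) tproj_eq_iff[OF assms(1)] by simp
  then have "{x \<in> topspace euclidean. tproj L x \<in> tproj L ` S} \<subseteq> S" by auto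
  then show ?thesis
    using quotient_map_tproj[of L] assms(2)
    unfolding quotient_map_saturated_closed closed_closedin by blast
qed

lemma closed_Union_components_locally_finite:
  fixes \<C> :: "'a::topological_space set set"
  assumes "locally_finite_in euclidean \<C>" "\<And>C. C \<in> \<C> \<Longrightarrow> closed C \<and> connected C"
    and \<K>: "\<K> \<subseteq> components (\<Union>\<C>)"
  shows "closed (\<Union>\<K>)"
proof -
  have "\<Union>\<K> \<subseteq> \<Union>{C \<in> \<C>. C \<subseteq> \<Union>\<K>}"
  proof
    fix x assume "x \<in> \<Union>\<K>"
    then obtain T where T: "T \<in> \<K>" "x \<in> T" by blast
    moreover obtain C where "C \<in> \<C>" "x \<in> C"
      using T \<K> in_components_subset by blast
    ultimately have "C \<subseteq> T"
      using components_maximal[of T "\<Union>\<C>" C] \<K> assms(2) by blast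
    then show "x \<in> \<Union>{C \<in> \<C>. C \<subseteq> \<Union>\<K>}"
      using T \<open>C \<in> \<C>\<close> \<open>x \<in> C\<close> by blast
  qed
  then have "\<Union>\<K> = \<Union>{C \<in> \<C>. C \<subseteq> \<Union>\<K>}" by blast
  moreover have "closedin euclidean (\<Union>{C \<in> \<C>. C \<subseteq> \<Union>\<K>})"
  proof (rule closedin_locally_finite_Union)
    show "locally_finite_in euclidean {C \<in> \<C>. C \<subseteq> \<Union>\<K>}"
      using assms(1) by (rule locally_finite_in_subset) blast
  qed (use assms(2) in simp)
  ultimately show ?thesis by simp
qed

locale torus_region =
  fixes L :: "'a::euclidean_space set" and \<Gamma> :: "'a set set"
  assumes int_subspace: "int_module.subspace L"
    and nonempty: "\<Gamma> \<noteq> {}"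
    and connectedin_torus: "connectedin (torus_top L) \<Gamma>"
    and closed_Union_components: "\<And>\<K>. \<K> \<subseteq> components (tproj L -` \<Gamma>) \<Longrightarrow> closed (\<Union>\<K>)"
begin

abbreviation preimage :: "'a set" where
  "preimage \<equiv> tproj L -` \<Gamma>"

abbreviation same_shadow :: "'a \<Rightarrow> 'a \<Rightarrow> bool" where
  "same_shadow \<equiv> connected_component preimage"

lemma tproj_image_preimage: "tproj L ` preimage = \<Gamma>"
  using connectedin_subset_topspace[OF connectedin_torus] by (auto simp: topspace_torus_top)

lemma preimage_translate_iff: "u \<in> L \<Longrightarrow> x + u \<in> preimage \<longleftrightarrow> x \<in> preimage"
  by (simp add: tproj_add[OF int_subspace])

lemma homeomorphism_translate:
  assumes "u \<in> L"
  shows "homeomorphism preimage preimage (\<lambda>x. x + u) (\<lambda>x. x - u)"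
proof (intro homeomorphismI continuous_intros image_subsetI)
  show "x + u \<in> preimage" if "x \<in> preimage" for x
    using that by (simp only: preimage_translate_iff[OF assms])
  show "x - u \<in> preimage" if "x \<in> preimage" for x
    using that preimage_translate_iff[OF assms, of "x - u"] by (simp only: diff_add_cancel)
qed simp_all

lemma same_shadow_translate_iff:
  assumes "u \<in> L"
  shows "same_shadow (x + u) (y + u) \<longleftrightarrow> same_shadow x y"
  using connected_component_homeomorphism_iff[OF homeomorphism_translate[OF assms], of x y]
    connected_component_in[of preimage "x + u" "y + u"] preimage_translate_iff[OF assms] by blast

lemma closed_saturated:
  assumes "A \<subseteq> preimage" "\<And>x y. x \<in> A \<Longrightarrow> same_shadow x y \<Longrightarrow> y \<in> A"
  shows "closed A"
proof -
  have "A = \<Union>(connected_component_set preimage ` A)"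
    using assms connected_component_refl by fastforce
  moreover have "connected_component_set preimage ` A \<subseteq> components preimage"
    using assms(1) by (auto simp: components_def)
  ultimately show ?thesis using closed_Union_components by metis
qed

text \<open>\<open>A\<close> and its complement project to disjoint closed sets covering the connected set \<open>\<Gamma>\<close>.\<close>

lemma saturated_invariant_trivial:
  assumes "A \<subseteq> preimage" and saturated: "\<And>x y. x \<in> A \<Longrightarrow> same_shadow x y \<Longrightarrow> y \<in> A"
    and invariant: "\<And>x u. x \<in> A \<Longrightarrow> u \<in> L \<Longrightarrow> x + u \<in> A"
  shows "A = {} \<or> A = preimage"
proof -
  define B where "B = preimage - A"
  have "closedin (torus_top L) (tproj L ` A)"
    using assms by (intro closedin_tproj_image int_subspace closed_saturated)
  moreover have "closedin (torus_top L) (tproj L ` B)"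
  proof (intro closedin_tproj_image int_subspace closed_saturated)
    show "y \<in> B" if "x \<in> B" "same_shadow x y" for x y
      using that saturated[of y x] connected_component_in[of preimage x y]
        connected_component_sym[of preimage x y] unfolding B_def by blast
    show "x + u \<in> B" if "x \<in> B" "u \<in> L" for x u
    proof -
      have "- u \<in> L" using int_subspace \<open>u \<in> L\<close> by (rule int_module.subspace_neg)
      then have "x + u \<notin> A" using invariant[of "x + u" "- u"] \<open>x \<in> B\<close> by (auto simp: B_def)
      then show ?thesis using \<open>x \<in> B\<close> preimage_translate_iff[OF \<open>u \<in> L\<close>] unfolding B_def by blast
    qed
  qed (simp add: B_def)
  moreover have "tproj L ` A \<inter> tproj L ` B = {}"
    using invariant[of _ "_ - _"] tproj_eq_iff[OF int_subspace] unfolding B_def by force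
  moreover have "A \<union> B = preimage" using assms(1) unfolding B_def by blast
  then have "tproj L ` A \<union> tproj L ` B = \<Gamma>"
    using tproj_image_preimage by (simp flip: image_Un)
  then have "\<Gamma> \<subseteq> tproj L ` A \<union> tproj L ` B" "tproj L ` A \<subseteq> \<Gamma>" "tproj L ` B \<subseteq> \<Gamma>" by blast+
  ultimately have "tproj L ` A \<inter> \<Gamma> = {} \<or> tproj L ` B \<inter> \<Gamma> = {}"
    using connectedin_torus unfolding connectedin_closedin by blast
  then have "A = {} \<or> B = {}"
    using \<open>tproj L ` A \<subseteq> \<Gamma>\<close> \<open>tproj L ` B \<subseteq> \<Gamma>\<close> by blast
  then show ?thesis using assms(1) unfolding B_def by blast
qed

lemma shadows_transitive:
  assumes y: "y \<in> preimage" and z: "z \<in> preimage"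
  obtains w where "w \<in> L" "same_shadow (y + w) z"
proof -
  define orbit where "orbit = {x. \<exists>w\<in>L. same_shadow (y + w) x}"
  have "orbit = {} \<or> orbit = preimage"
  proof (rule saturated_invariant_trivial)
    show "orbit \<subseteq> preimage" unfolding orbit_def using connected_component_in by blast
    show "x' \<in> orbit" if "x \<in> orbit" "same_shadow x x'" for x x'
      using that connected_component_trans[of preimage] unfolding orbit_def by blast
    show "x + u \<in> orbit" if "x \<in> orbit" "u \<in> L" for x u
    proof -
      obtain w where w: "w \<in> L" "same_shadow (y + w) x"
        using \<open>x \<in> orbit\<close> unfolding orbit_def by blast
      then have "same_shadow (y + (w + u)) (x + u)"
        using same_shadow_translate_iff[OF \<open>u \<in> L\<close>] by (simp flip: add.assoc)
      then show ?thesis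
        unfolding orbit_def using int_module.subspace_add[OF int_subspace w(1) \<open>u \<in> L\<close>] by blast
    qed
  qed
  moreover have "same_shadow (y + 0) y" using y by (simp add: connected_component_refl)
  then have "y \<in> orbit"
    unfolding orbit_def using int_module.subspace_0[OF int_subspace] by blast
  ultimately have "z \<in> orbit" using z by blast
  then show ?thesis using that unfolding orbit_def by blast
qed

lemma translate_component_eq_iff:
  assumes "u \<in> L" "z \<in> preimage"
  shows "(\<lambda>x. x + u) ` connected_component_set preimage z = connected_component_set preimage z
     \<longleftrightarrow> same_shadow z (z + u)"
proof -
  have "z + u \<in> preimage" using assms by (simp only: preimage_translate_iff)
  moreover have "(\<lambda>x. x + u) ` connected_component_set preimage z
      = connected_component_set preimage (z + u)"
    using homeomorphism_translate[OF assms(1)] assms(2)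
    by (rule connected_component_set_homeomorphism[symmetric])
  ultimately show ?thesis
    using assms(2) connected_component_sym[of preimage] connected_component_eq_eq[of preimage]
    by simp blast
qed

lemma same_shadow_translate_indep:
  assumes "y \<in> preimage" "z \<in> preimage" "u \<in> L"
  shows "same_shadow z (z + u) \<longleftrightarrow> same_shadow y (y + u)"
proof -
  obtain w where w: "w \<in> L" "same_shadow (y + w) z" using shadows_transitive[OF assms(1,2)] .
  have "same_shadow (y + w + u) (z + u)" using w(2) same_shadow_translate_iff[OF assms(3)] by simp
  then have "same_shadow z (z + u) \<longleftrightarrow> same_shadow (y + w) (y + w + u)"
    using w(2) connected_component_trans connected_component_sym by metis
  also have "\<dots> \<longleftrightarrow> same_shadow (y + w) (y + u + w)" by (simp add: add_ac)
  also have "\<dots> \<longleftrightarrow> same_shadow y (y + u)" by (rule same_shadow_translate_iff[OF w(1)])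
  finally show ?thesis .
qed

lemma period_lattice_eq:
  assumes "y \<in> preimage"
  shows "period_lattice L \<Gamma> = {u \<in> L. same_shadow y (y + u)}"
proof -
  have "shadow L \<Gamma> \<in> components preimage"
    unfolding shadow_def vimage_def[symmetric] some_in_eq using assms by auto
  then obtain z where z: "z \<in> preimage"
      and shadow: "shadow L \<Gamma> = connected_component_set preimage z"
    by (auto simp: components_def)
  have "(\<lambda>x. x + u) ` shadow L \<Gamma> = shadow L \<Gamma> \<longleftrightarrow> same_shadow y (y + u)" if "u \<in> L" for u
    unfolding shadow translate_component_eq_iff[OF that z]
    by (rule same_shadow_translate_indep[OF assms z that])
  then show ?thesis unfolding period_lattice_def by blast
qed

lemma int_subspace_period_lattice: "int_module.subspace (period_lattice L \<Gamma>)"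
proof -
  obtain y where y: "y \<in> preimage" using nonempty tproj_image_preimage by blast
  show ?thesis
    unfolding period_lattice_eq[OF y]
  proof (rule int_subspaceI)
    show "0 \<in> {u \<in> L. same_shadow y (y + u)}"
      using int_module.subspace_0[OF int_subspace] y by (simp add: connected_component_refl)
    fix u v assume uv: "u \<in> {u \<in> L. same_shadow y (y + u)}" "v \<in> {u \<in> L. same_shadow y (y + u)}"
    then have "u - v \<in> L" using int_module.subspace_diff[OF int_subspace] by blast
    moreover have "same_shadow (y + (u - v)) y"
      using uv same_shadow_translate_iff[of v "y + (u - v)" y]
      by (auto simp: algebra_simps intro: connected_component_trans connected_component_sym)
    ultimately show "u - v \<in> {u \<in> L. same_shadow y (y + u)}"
      using connected_component_sym by fast
  qed
qed

end

lemma shadow_monomial_antimono: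
  fixes L :: "'a::euclidean_space set"
  assumes L: "is_lattice L" and "torus_region L \<Gamma>" "torus_region L \<Delta>" "\<Gamma> \<subseteq> \<Delta>"
  shows "mono_le (shadow_monomial L \<Delta>) (shadow_monomial L \<Gamma>)"
proof -
  interpret \<Gamma>: torus_region L \<Gamma> by fact
  interpret \<Delta>: torus_region L \<Delta> by fact
  define P where "P = period_lattice L \<Gamma>"
  define Q where "Q = period_lattice L \<Delta>"
  obtain y where y: "y \<in> tproj L -` \<Gamma>" using \<Gamma>.nonempty \<Gamma>.tproj_image_preimage by blast
  then have y': "y \<in> tproj L -` \<Delta>" using \<open>\<Gamma> \<subseteq> \<Delta>\<close> by blast
  have "P \<subseteq> Q"
    unfolding P_def Q_def \<Gamma>.period_lattice_eq[OF y] \<Delta>.period_lattice_eq[OF y']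
    using connected_component_of_subset[OF _ vimage_mono[OF \<open>\<Gamma> \<subseteq> \<Delta>\<close>]] by blast
  have lattice: "is_lattice P" "is_lattice Q"
    unfolding P_def Q_def
    using is_lattice_int_subspace[OF L] \<Gamma>.int_subspace_period_lattice \<Delta>.int_subspace_period_lattice
    by (simp_all add: period_lattice_def)
  have "lattice_dim P \<le> lattice_dim Q" "lattice_dim Q \<le> DIM('a)"
    unfolding lattice_dim_def using \<open>P \<subseteq> Q\<close> by (simp_all add: dim_subset dim_subset_UNIV)
  then consider (less) "lattice_dim P < lattice_dim Q" "lattice_dim Q \<le> DIM('a)"
    | (equal) "lattice_dim P = lattice_dim Q" by linarith
  then show ?thesis
  proof cases
    case less
    then have "DIM('a) - lattice_dim Q < DIM('a) - lattice_dim P" by linarith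
    then show ?thesis
      by (simp add: mono_le_def shadow_monomial_def Let_def flip: P_def Q_def)
  next
    case equal
    have "lattice_vol Q \<le> lattice_vol P"
      using lattice \<open>P \<subseteq> Q\<close> equal by (rule lattice_vol_antimono)
    moreover have "0 \<le> lattice_vol L" by (simp add: lattice_vol_def pvol_def Let_def)
    ultimately show ?thesis
      using equal
      unfolding mono_le_def shadow_monomial_def Let_def P_def[symmetric] Q_def[symmetric]
      by (auto intro!: mult_right_mono divide_right_mono)
  qed
qed

section \<open>Sublevel sets of periodic filters\<close>

lemma cell_complex_cellD:
  fixes K :: "'a::euclidean_space set set"
  assumes "cell_complex K" "\<sigma> \<in> K"
  shows "closed \<sigma>" "connected \<sigma>"
proof -
  obtain S :: "'a set" and h h' where S: "subspace S" and "homeomorphism (cball 0 1 \<inter> S) \<sigma> h h'"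
    using assms unfolding cell_complex_def by meson
  then have h: "h ` (cball 0 1 \<inter> S) = \<sigma>" "continuous_on (cball 0 1 \<inter> S) h"
    by (auto simp: homeomorphism_def)
  have "compact (cball 0 1 \<inter> S)" using S by (simp add: closed_subspace compact_Int_closed)
  then show "closed \<sigma>" using compact_continuous_image[OF h(2)] h(1) compact_imp_closed by metis
  have "convex (cball 0 1 \<inter> S)" using S by (simp add: convex_Int subspace_imp_convex)
  then show "connected \<sigma>" using connected_continuous_image[OF h(2)] convex_connected h(1) by metis
qed

lemma cell_complex_locally_finite:
  fixes K :: "'a::euclidean_space set set"
  assumes "cell_complex K"
  shows "locally_finite_in euclidean K"
  unfolding locally_finite_in_def
proof (intro conjI ballI)
  fix x :: 'a
  obtain e where "e > 0" "finite {\<sigma> \<in> K. \<sigma> \<inter> ball x e \<noteq> {}}"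
    using assms unfolding cell_complex_def by meson
  then show "\<exists>V. openin euclidean V \<and> x \<in> V \<and> finite {\<sigma> \<in> K. \<sigma> \<inter> V \<noteq> {}}"
    by (intro exI[of _ "ball x e"]) simp
qed simp

lemma vimage_tsub_component_eq_Union_cells:
  fixes L :: "'a::euclidean_space set"
  assumes L: "int_module.subspace L" and K: "cell_complex K" "periodic_complex K L"
    and F: "periodic_filter K L F"
    and \<Gamma>: "\<Gamma> \<in> connected_components_of (subtopology (torus_top L) (tsub K F L s))"
  shows "tproj L -` \<Gamma> = \<Union>{\<sigma> \<in> K. \<sigma> \<subseteq> tproj L -` \<Gamma>}"
proof (intro equalityI subsetI)
  fix y assume y: "y \<in> tproj L -` \<Gamma>"
  then have "tproj L y \<in> tsub K F L s" using connected_components_of_subset[OF \<Gamma>] by auto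
  then obtain \<rho> z where \<rho>: "\<rho> \<in> K" "F \<rho> \<le> s" "z \<in> \<rho>" "tproj L z = tproj L y"
    unfolding tsub_def by fastforce
  define \<sigma> where "\<sigma> = (\<lambda>x. x + (y - z)) ` \<rho>"
  have "y - z \<in> L" using \<rho>(4) tproj_eq_iff[OF L] by blast
  then have "\<sigma> \<in> K" "F \<sigma> \<le> s"
    using K(2) F \<rho>(1,2) unfolding \<sigma>_def periodic_complex_def periodic_filter_def by auto
  have "y \<in> \<sigma>" unfolding \<sigma>_def using \<rho>(3) by force
  have "connectedin (torus_top L) (tproj L ` \<sigma>)"
    using cell_complex_cellD(2)[OF K(1) \<open>\<sigma> \<in> K\<close>] quotient_imp_continuous_map[OF quotient_map_tproj]
    by (intro connectedin_continuous_map_image) auto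
  moreover have "tproj L ` \<sigma> \<subseteq> tsub K F L s"
    unfolding tsub_def using \<open>\<sigma> \<in> K\<close> \<open>F \<sigma> \<le> s\<close> by blast
  moreover have "\<not> disjnt \<Gamma> (tproj L ` \<sigma>)" using y \<open>y \<in> \<sigma>\<close> by (auto simp: disjnt_iff)
  ultimately have "tproj L ` \<sigma> \<subseteq> \<Gamma>"
    using connected_components_of_maximal[OF \<Gamma>] by (simp add: connectedin_subtopology)
  then show "y \<in> \<Union>{\<sigma> \<in> K. \<sigma> \<subseteq> tproj L -` \<Gamma>}" using \<open>\<sigma> \<in> K\<close> \<open>y \<in> \<sigma>\<close> by blast
qed blast

lemma torus_region_tsub_component:
  fixes L :: "'a::euclidean_space set"
  assumes L: "int_module.subspace L" and K: "cell_complex K" "periodic_complex K L"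
    and F: "periodic_filter K L F"
    and \<Gamma>: "\<Gamma> \<in> connected_components_of (subtopology (torus_top L) (tsub K F L s))"
  shows "torus_region L \<Gamma>"
proof
  show "\<Gamma> \<noteq> {}" using \<Gamma> by (rule nonempty_connected_components_of)
  show "connectedin (torus_top L) \<Gamma>"
    using connectedin_connected_components_of[OF \<Gamma>] by (simp add: connectedin_subtopology)
  let ?\<C> = "{\<sigma> \<in> K. \<sigma> \<subseteq> tproj L -` \<Gamma>}"
  have "tproj L -` \<Gamma> = \<Union>?\<C>" using assms by (rule vimage_tsub_component_eq_Union_cells)
  moreover have "locally_finite_in euclidean ?\<C>"
    by (rule locally_finite_in_subset[OF cell_complex_locally_finite[OF K(1)]]) blast
  moreover have "closed \<sigma> \<and> connected \<sigma>" if "\<sigma> \<in> ?\<C>" for \<sigma>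
    using that cell_complex_cellD[OF K(1)] by blast
  ultimately show "closed (\<Union>\<K>)" if "\<K> \<subseteq> components (tproj L -` \<Gamma>)" for \<K>
    using that closed_Union_components_locally_finite[of ?\<C> \<K>] by simp
qed fact

section \<open>Interleaving of merge trees\<close>

lemma topspace_mt_top:
  "topspace (mt_top T Sub) = {(A, s). A \<in> connected_components_of (subtopology T (Sub s))}"
  unfolding mt_top_def topspace_qtop mt_pt_def connected_components_of_def
  by (auto simp: image_iff)

text \<open>If \<open>A\<close> is a connected subset of \<open>Sub (s + \<epsilon>)\<close>, the union is the component containing \<open>A\<close>.\<close>

definition merge_shift ::
    "'b topology \<Rightarrow> (real \<Rightarrow> 'b set) \<Rightarrow> real \<Rightarrow> 'b set \<times> real \<Rightarrow> 'b set \<times> real" where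
  "merge_shift T Sub \<epsilon> = (\<lambda>(A, s).
     (\<Union>x\<in>A. connected_component_of_set (subtopology T (Sub (s + \<epsilon>))) x, s + \<epsilon>))"

lemma snd_merge_shift: "snd (merge_shift T Sub \<epsilon> \<Gamma>) = snd \<Gamma> + \<epsilon>"
  by (simp add: merge_shift_def case_prod_beta)

lemma fst_subset_merge_shift:
  assumes "\<Gamma> \<in> topspace (mt_top T Sub)" "\<And>s. Sub s \<subseteq> Sub' (s + \<epsilon>)"
  shows "fst \<Gamma> \<subseteq> fst (merge_shift T Sub' \<epsilon> \<Gamma>)"
proof
  fix x assume "x \<in> fst \<Gamma>"
  moreover have "fst \<Gamma> \<subseteq> topspace T \<inter> Sub (snd \<Gamma>)"
    using assms(1) connected_components_of_subset by (fastforce simp: topspace_mt_top)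
  ultimately have "connected_component_of (subtopology T (Sub' (snd \<Gamma> + \<epsilon>))) x x"
    using assms(2) by (auto simp: connected_component_of_refl)
  then show "x \<in> fst (merge_shift T Sub' \<epsilon> \<Gamma>)"
    using \<open>x \<in> fst \<Gamma>\<close> by (auto simp: merge_shift_def case_prod_beta)
qed

lemma merge_shift_mt_pt:
  assumes "x \<in> topspace T" "x \<in> Sub s" "Sub s \<subseteq> Sub' (s + \<epsilon>)"
  shows "merge_shift T Sub' \<epsilon> (mt_pt T Sub (x, s)) = mt_pt T Sub' (x, s + \<epsilon>)"
proof -
  let ?X = "subtopology T (Sub s)" and ?Y = "subtopology T (Sub' (s + \<epsilon>))"
  have "(\<Union>y\<in>connected_component_of_set ?X x. connected_component_of_set ?Y y)
      = connected_component_of_set ?Y x"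
  proof (rule SUP_eq_const)
    have "connected_component_of ?X x x" using assms by (simp add: connected_component_of_refl)
    then show "connected_component_of_set ?X x \<noteq> {}" by blast
    show "connected_component_of_set ?Y y = connected_component_of_set ?Y x"
      if "y \<in> connected_component_of_set ?X x" for y
      using that connected_component_of_mono[OF _ assms(3)] connected_component_of_equiv
      unfolding mem_Collect_eq by metis
  qed
  then show ?thesis by (simp add: merge_shift_def mt_pt_def)
qed

lemma continuous_map_merge_shift:
  assumes "\<And>s. Sub s \<subseteq> Sub' (s + \<epsilon>)"
  shows "continuous_map (mt_top T Sub) (mt_top T Sub') (merge_shift T Sub' \<epsilon>)"
proof -
  define P where "P S = subtopology (prod_topology T euclideanreal) {(x, s). x \<in> S s}"
    for S :: "real \<Rightarrow> 'a set"
  have "continuous_map (prod_topology T euclideanreal) (prod_topology T euclideanreal)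
      (\<lambda>z. (fst z, snd z + \<epsilon>))"
    by (intro continuous_map_pairedI continuous_map_fst continuous_map_add continuous_map_snd
        continuous_map_const[THEN iffD2]) simp
  then have "continuous_map (P Sub) (P Sub') (\<lambda>z. (fst z, snd z + \<epsilon>))"
    unfolding P_def
    by (auto simp: continuous_map_in_subtopology intro: continuous_map_from_subtopology
        dest: subsetD[OF assms])
  then have "continuous_map (P Sub) (mt_top T Sub') (mt_pt T Sub' \<circ> (\<lambda>z. (fst z, snd z + \<epsilon>)))"
    unfolding mt_top_def P_def[symmetric]
    using quotient_imp_continuous_map[OF quotient_map_qtop] by (rule continuous_map_compose)
  moreover have
    "(mt_pt T Sub' \<circ> (\<lambda>z. (fst z, snd z + \<epsilon>))) z = (merge_shift T Sub' \<epsilon> \<circ> mt_pt T Sub) z"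
    if "z \<in> topspace (P Sub)" for z
    using that merge_shift_mt_pt[of "fst z" T Sub "snd z" Sub' \<epsilon>] assms by (auto simp: P_def)
  ultimately have "continuous_map (P Sub) (mt_top T Sub') (merge_shift T Sub' \<epsilon> \<circ> mt_pt T Sub)"
    by (rule continuous_map_eq)
  then show ?thesis
    unfolding mt_top_def[of T Sub] P_def[symmetric]
    by (rule continuous_compose_quotient_map[OF quotient_map_qtop])
qed

lemma tsub_mono:
  assumes "\<And>\<sigma>. \<sigma> \<in> K \<Longrightarrow> F \<sigma> \<le> s \<Longrightarrow> G \<sigma> \<le> t"
  shows "tsub K F L s \<subseteq> tsub K G L t"
  unfolding tsub_def using assms by blast

lemma mono_le_frq_pmt:
  fixes L :: "'a::euclidean_space set"
  assumes F: "admissible K F L" and G: "admissible K G L"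
    and A: "A \<in> topspace (mtop (pmt K F L))" and B: "B \<in> topspace (mtop (pmt K G L))"
    and "fst A \<subseteq> fst B"
  shows "mono_le (frq (pmt K G L) B) (frq (pmt K F L) A)"
proof -
  have "is_lattice L" using F by (simp add: admissible_def)
  then have "torus_region L (fst A)" "torus_region L (fst B)"
    using A B F G torus_region_tsub_component[OF int_subspace_lattice]
    by (auto simp: pmt_def topspace_mt_top admissible_def)
  then show ?thesis
    using shadow_monomial_antimono[OF \<open>is_lattice L\<close>] \<open>fst A \<subseteq> fst B\<close> by (simp add: pmt_def)
qed

lemma continuous_map_merge_shift_pmt:
  assumes "\<And>s. tsub K F L s \<subseteq> tsub K G L (s + \<epsilon>)"
  shows "continuous_map (mtop (pmt K F L)) (mtop (pmt K G L))
    (merge_shift (torus_top L) (tsub K G L) \<epsilon>)"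
  using assms by (simp add: pmt_def continuous_map_merge_shift)

lemma merge_shift_pmt:
  fixes L :: "'a::euclidean_space set"
  assumes F: "admissible K F L" and G: "admissible K G L" and "0 \<le> \<epsilon>"
    and FG: "\<And>s. tsub K F L s \<subseteq> tsub K G L (s + \<epsilon>)"
    and GF: "\<And>s. tsub K G L s \<subseteq> tsub K F L (s + \<epsilon>)"
    and \<Gamma>: "\<Gamma> \<in> topspace (mtop (pmt K F L))"
  defines "\<phi> \<equiv> merge_shift (torus_top L) (tsub K G L) \<epsilon>"
    and "\<psi> \<equiv> merge_shift (torus_top L) (tsub K F L) \<epsilon>"
  shows "hgt (pmt K G L) (\<phi> \<Gamma>) = hgt (pmt K F L) \<Gamma> + \<epsilon>"
    and "covers (pmt K F L) (\<psi> (\<phi> \<Gamma>)) \<Gamma>"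
    and "mono_le (frq (pmt K G L) (\<phi> \<Gamma>)) (frq (pmt K F L) \<Gamma>)"
proof -
  show "hgt (pmt K G L) (\<phi> \<Gamma>) = hgt (pmt K F L) \<Gamma> + \<epsilon>"
    by (simp add: \<phi>_def pmt_def snd_merge_shift)
  have \<phi>\<Gamma>: "\<phi> \<Gamma> \<in> topspace (mtop (pmt K G L))"
    unfolding \<phi>_def
    using continuous_map_merge_shift_pmt[OF FG] \<Gamma> continuous_map_image_subset_topspace by blast
  have subset: "fst \<Gamma> \<subseteq> fst (\<phi> \<Gamma>)"
    unfolding \<phi>_def using \<Gamma> FG by (intro fst_subset_merge_shift) (simp_all add: pmt_def)
  also have "\<dots> \<subseteq> fst (\<psi> (\<phi> \<Gamma>))"
    unfolding \<psi>_def using \<phi>\<Gamma> GF by (intro fst_subset_merge_shift) (simp_all add: pmt_def)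
  finally show "covers (pmt K F L) (\<psi> (\<phi> \<Gamma>)) \<Gamma>"
    using \<open>0 \<le> \<epsilon>\<close> by (simp add: covers_def pmt_def \<phi>_def \<psi>_def snd_merge_shift)
  show "mono_le (frq (pmt K G L) (\<phi> \<Gamma>)) (frq (pmt K F L) \<Gamma>)"
    using F G \<Gamma> \<phi>\<Gamma> subset by (rule mono_le_frq_pmt)
qed

lemma compatible_merge_shift:
  fixes L :: "'a::euclidean_space set"
  assumes F: "admissible K F L" and G: "admissible K G L"
    and "0 \<le> \<epsilon>" and close: "\<And>\<sigma>. \<sigma> \<in> K \<Longrightarrow> \<bar>F \<sigma> - G \<sigma>\<bar> \<le> \<epsilon>"
  shows "compatible \<epsilon> (pmt K F L) (pmt K G L)
     (merge_shift (torus_top L) (tsub K G L) \<epsilon>) (merge_shift (torus_top L) (tsub K F L) \<epsilon>)"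
proof -
  have "tsub K F L s \<subseteq> tsub K G L (s + \<epsilon>)" "tsub K G L s \<subseteq> tsub K F L (s + \<epsilon>)" for s
    using close by (force intro!: tsub_mono simp: abs_le_iff)+
  then show ?thesis
    unfolding compatible_def
    using merge_shift_pmt[OF F G \<open>0 \<le> \<epsilon>\<close>] merge_shift_pmt[OF G F \<open>0 \<le> \<epsilon>\<close>]
      continuous_map_merge_shift_pmt by blast
qed

lemma dI_le: "0 \<le> \<epsilon> \<Longrightarrow> compatible \<epsilon> M M' \<phi> \<psi> \<Longrightarrow> dI M M' \<le> ereal \<epsilon>"
  unfolding dI_def by (rule Inf_lower) blast

lemma dI_refl: "dI M M = 0"
proof (rule antisym)
  have "compatible 0 M M id id"
    unfolding compatible_def covers_def mono_le_def by simp
  then show "dI M M \<le> 0" using dI_le[of 0] by (simp add: zero_ereal_def)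
  show "0 \<le> dI M M" unfolding dI_def by (rule Inf_greatest) auto
qed

lemma splinters_refl: "splinters M M"
proof -
  have "{A \<in> topspace (mtop M). id A = \<Gamma>} = {\<Gamma>}" if "\<Gamma> \<in> topspace (mtop M)" for \<Gamma>
    using that by auto
  then show ?thesis
    unfolding splinters_def by (intro exI[of _ id]) (simp add: dI_refl)
qed

lemma pmt_equiv_refl: "M \<in> pmtrees \<Longrightarrow> pmt_equiv M M"
  unfolding pmt_equiv_def using splinters_refl by blast

lemma J_dist_le_dI:
  assumes "M \<in> pmtrees" "M' \<in> pmtrees"
  shows "J_dist M M' \<le> dI M M'"
  unfolding J_dist_def
  by (rule Inf_lower, intro CollectI exI[of _ 1] exI[of _ "\<lambda>_. M"] exI[of _ "\<lambda>_. M'"])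
    (simp add: assms pmt_equiv_refl)

lemma sup_dist_nonneg: "0 \<le> sup_dist K F G"
  unfolding sup_dist_def by (rule Sup_upper) simp

lemma abs_diff_le_sup_dist: "\<sigma> \<in> K \<Longrightarrow> ereal \<bar>F \<sigma> - G \<sigma>\<bar> \<le> sup_dist K F G"
  unfolding sup_dist_def by (rule Sup_upper) simp

theorem mainTheorem3:
  fixes L :: "'a::euclidean_space set" and K :: "'a set set" and F G :: "'a set \<Rightarrow> real"
  assumes "is_lattice L" and "lattice_dim L = DIM('a)"
    and "cell_complex K" and "periodic_complex K L"
    and "periodic_filter K L F" and "periodic_filter K L G"
  shows "dI (pmt K F L) (pmt K G L) \<le> sup_dist K F G \<and>
         J_dist (pmt K F L) (pmt K G L) \<le> sup_dist K F G"
proof -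
  have admissible: "admissible K F L" "admissible K G L"
    using assms by (simp_all add: admissible_def)
  have "dI (pmt K F L) (pmt K G L) \<le> sup_dist K F G"
  proof (cases "sup_dist K F G")
    case (real \<epsilon>)
    then have "0 \<le> \<epsilon>" "\<And>\<sigma>. \<sigma> \<in> K \<Longrightarrow> \<bar>F \<sigma> - G \<sigma>\<bar> \<le> \<epsilon>"
      using sup_dist_nonneg[of K F G] abs_diff_le_sup_dist[of _ K F G] by simp_all
    then show ?thesis
      unfolding real using dI_le compatible_merge_shift[OF admissible] by blast
  next
    case MInf
    then show ?thesis using sup_dist_nonneg[of K F G] by simp
  qed simp
  moreover have "pmt K F L \<in> pmtrees" "pmt K G L \<in> pmtrees"
    using admissible unfolding pmtrees_def by blast+
  ultimately show ?thesis using J_dist_le_dI order_trans by blast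
qed

end
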